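(* Let $m\le n$ and $k\ge 1$. Suppose that for every 1D array of size $n$ there is an $S(n,k)$-bit encoding from which sorted 2-sided Top-$k$ queries can be answered. Then every $m\times n$ array $A$ admits an encoding of $mS(n,k)+2nm(m-1)$ bits from which every sorted 4-sided Top-$k$ query on $A$ can be answered. In particular, using a $(\lg\binom{(k+1)n}{n}+o(n))$-bit encoding for sorted 2-sided Top-$k$ queries on 1D arrays, one obtains an encoding of $m\lg\binom{(k+1)n}{n}+2nm(m-1)+o(n)$ bits for sorted 4-sided Top-$k$ queries on $m\times n$ arrays.
   Context: All arrays have pairwise distinct entries from a totally ordered set. For a 1D array $B[1..n]$ and $1\le i\le j\le n$, the query Top-$k(i,j,B)$ returns the positions of the $k$ largest values of $B[i..j]$ (all positions if it has at most $k$ entries); a query is sorted if the positions must be reported in decreasing order of their values; 2-sided queries allow arbitrary $i\le j$. For an $m\times n$ array $A$, Top-$k(i,j,a,b,A)$ (with $1\le i\le j\le m$, $1\le a\le b\le n$) returns the positions of the $k$ largest values in the subarray $A[i..j][a..b]$; 4-sided queries allow arbitrary such $i,j,a,b$. An $s$-bit encoding supporting a family of queries is a map assigning to each array a bit string of length at most $s$ such that every query of the family can be answered from this bit string alone, without access to the array. *)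

theory Defs
  imports Complex_Main "HOL-Library.Landau_Symbols"
begin

text \<open>Positions are 0-based. The sorted Top-k answer on a finite set P of positions
  (values given by an injective val) is the list of the min(k,|P|) positions of
  largest value, in decreasing order of value.\<close>

definition topk :: "nat \<Rightarrow> ('p \<Rightarrow> 'a::linorder) \<Rightarrow> 'p set \<Rightarrow> 'p list" where
  "topk k val P = take k (THE xs. distinct xs \<and> set xs = P \<and> sorted_wrt (\<lambda>p q. val q < val p) xs)"

definition encodable :: "real \<Rightarrow> 'x set \<Rightarrow> 'q set \<Rightarrow> ('x \<Rightarrow> 'q \<Rightarrow> 'r) \<Rightarrow> bool" where
  "encodable s Arrs Qs ans \<longleftrightarrow>
     (\<exists>(enc :: 'x \<Rightarrow> bool list) (dec :: bool list \<Rightarrow> 'q \<Rightarrow> 'r).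
        \<forall>A\<in>Arrs. real (length (enc A)) \<le> s \<and> (\<forall>q\<in>Qs. dec (enc A) q = ans A q))"

definition arrays1 :: "nat \<Rightarrow> (nat \<Rightarrow> 'a) set" where
  "arrays1 n = {B. inj_on B {0..<n}}"

definition queries1 :: "nat \<Rightarrow> (nat \<times> nat) set" where
  "queries1 n = {(i, j). i \<le> j \<and> j < n}"

definition ans1 :: "nat \<Rightarrow> (nat \<Rightarrow> 'a::linorder) \<Rightarrow> nat \<times> nat \<Rightarrow> nat list" where
  "ans1 k B q = (case q of (i, j) \<Rightarrow> topk k B {i..j})"

definition arrays2 :: "nat \<Rightarrow> nat \<Rightarrow> (nat \<times> nat \<Rightarrow> 'a) set" where
  "arrays2 m n = {A. inj_on A ({0..<m} \<times> {0..<n})}"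

definition queries2 :: "nat \<Rightarrow> nat \<Rightarrow> (nat \<times> nat \<times> nat \<times> nat) set" where
  "queries2 m n = {(i, j, a, b). i \<le> j \<and> j < m \<and> a \<le> b \<and> b < n}"

definition ans2 :: "nat \<Rightarrow> (nat \<times> nat \<Rightarrow> 'a::linorder) \<Rightarrow> nat \<times> nat \<times> nat \<times> nat \<Rightarrow> (nat \<times> nat) list" where
  "ans2 k A q = (case q of (i, j, a, b) \<Rightarrow> topk k A ({i..j} \<times> {a..b}))"

end

theory Submission
  imports Defs "HOL-Library.FuncSet"
begin

text \<open>Since an encoding need not be computable, only the number of distinct answer profiles matters.
  All Top-k answers on a set of rows are determined by the answers on single rows and on pairs of rows,
  so it suffices to show that two rows with given one-dimensional answers have at most
  \<open>2 ^ (4 * n - 2)\<close> joint profiles; the two bits saved per pair pay for the fact that bit strings of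
  length at most s are more numerous than those of length exactly s.

  To count, interleave the two rows into one array of \<open>2 * n\<close> positions, and emit entries one at a
  time, an entry w being emitted once it is known to exceed every remaining entry l for which fewer
  than k emitted entries lie between w and l. Within its own row this is decided by the
  row profile. In the other row it suffices to compare w with the greatest visible entry y to its left
  and the greatest one to its right. If w is the greatest remaining entry of some array under
  consideration, then w is in turn the greatest entry visible from y on w's side, so whichever of the two
  wins has settled one of its two sides for good. Hence every entry wins at most two informative comparisons.\<close>

section \<open>Counting the mergings of two rows\<close>

definition segment :: "nat \<Rightarrow> nat \<Rightarrow> nat set" where
  "segment p q = {min p q .. max p q}"

text \<open>The comparisons that Top-k answers reveal: fewer than k entries lie above w in the
  smallest segment containing w and l, so the answer on that segment lists w, and l later or not at
  all. This set is the profile that gets counted.\<close>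

definition dominance :: "nat \<Rightarrow> (nat \<Rightarrow> 'a::linorder) \<Rightarrow> nat set \<Rightarrow> (nat \<times> nat) set" where
  "dominance k v P =
     {(w, l). w \<in> P \<and> l \<in> P \<and> v l < v w \<and> card {e \<in> P \<inter> segment w l. v w < v e} < k}"

definition on_side :: "bool \<Rightarrow> nat \<Rightarrow> nat \<Rightarrow> bool" where
  "on_side s e l \<longleftrightarrow> (if s then l < e else e < l)"

lemma finite_has_greatest:
  fixes v :: "'p \<Rightarrow> 'a::linorder"
  assumes "finite S" "S \<noteq> {}"
  shows "\<exists>x\<in>S. \<forall>y\<in>S. v y \<le> v x"
proof -
  have "Max (v ` S) \<in> v ` S" using assms by (intro Max_in) auto
  then obtain x where "x \<in> S" "Max (v ` S) = v x" by blast
  then show ?thesis using assms(1) by (metis Max_ge finite_imageI imageI)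
qed

lemma finite_segment [simp]: "finite (segment p q)"
  by (simp add: segment_def)

lemma segment_commute: "segment p q = segment q p"
  by (simp add: segment_def min.commute max.commute)

lemma segment_mem [simp]: "p \<in> segment p q" "q \<in> segment p q"
  by (auto simp: segment_def)

lemma segment_mono: "e \<in> segment p q \<Longrightarrow> segment e q \<subseteq> segment p q"
  by (auto simp: segment_def)

lemma segment_mono2: "e \<in> segment p q \<Longrightarrow> segment p e \<subseteq> segment p q"
  by (auto simp: segment_def)

text \<open>Of y and l, the one farther from w spans with w a segment covering all that lies between
  y and l. Bounds on the emitted entries seen from w thus pass to
  \<open>segment y l\<close>.\<close>

lemma segment_on_side:
  assumes "on_side s w y" "on_side s w l"
  shows "segment y l \<subseteq> segment y w \<or> segment y l \<subseteq> segment l w"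
  using assms by (auto simp: on_side_def segment_def split: if_splits)

lemma on_side_segment:
  assumes "on_side s w y" "on_side s w l" "e \<in> segment y l"
  shows "on_side s w e"
  using assms by (auto simp: on_side_def segment_def split: if_splits)

lemma on_side_flip: "on_side s w y \<Longrightarrow> on_side (\<not> s) y w"
  by (auto simp: on_side_def split: if_splits)

lemma on_side_exhaust: "p \<noteq> q \<Longrightarrow> \<exists>s. on_side s p q"
  by (rule exI[of _ "q < p"]) (auto simp: on_side_def)

lemma dominance_mem:
  "(w, l) \<in> dominance k v P \<longleftrightarrow>
     w \<in> P \<and> l \<in> P \<and> v l < v w \<and> card {e \<in> P \<inter> segment w l. v w < v e} < k"
  by (simp add: dominance_def)

lemma card_segment_step:
  assumes "p \<noteq> w"
  obtains p' where "p' \<in> segment w p" "segment w p = insert p (segment w p')" "card (segment w p') < card (segment w p)"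
proof -
  define p' where "p' = (if p < w then p + 1 else p - 1)"
  have "segment w p = insert p (segment w p')" "p \<notin> segment w p'" "p' \<in> segment w p"
    using assms by (auto simp: p'_def segment_def)
  moreover from this have "card (segment w p') < card (segment w p)" by simp
  ultimately show ?thesis using that by blast
qed

text \<open>A discrete intermediate value argument: moving the far end one step towards w drops at
  most one entry of U, and at w itself none is left.\<close>

lemma exact_subsegment:
  assumes "w \<notin> U" "k \<le> card (U \<inter> segment w l)"
  shows "\<exists>p \<in> segment w l. card (U \<inter> segment w p) = k"
  using assms(2)
proof (induction "card (segment w l)" arbitrary: l rule: less_induct)
  case less
  show ?case
  proof (cases "card (U \<inter> segment w l) = k")
    case True
    then show ?thesis by (auto intro: segment_mem)
  next
    case False
    with less.prems have gt: "k < card (U \<inter> segment w l)" by simp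
    have "l \<noteq> w"
    proof
      assume "l = w"
      then have "U \<inter> segment w l = {}" using assms(1) by (auto simp: segment_def)
      with gt show False by simp
    qed
    then obtain p where p: "p \<in> segment w l" "segment w l = insert l (segment w p)"
      "card (segment w p) < card (segment w l)" by (rule card_segment_step)
    have "card (U \<inter> segment w l) \<le> card (insert l (U \<inter> segment w p))"
      by (rule card_mono) (use p(2) in auto)
    also have "\<dots> \<le> Suc (card (U \<inter> segment w p))" by (rule card_insert_le_m1) auto
    finally have "k \<le> card (U \<inter> segment w p)" using gt by simp
    from less.hyps[OF p(3) this] show ?thesis using segment_mono2[OF p(1)] by blast
  qed
qed

text \<open>Here Z is the set of arrays still under consideration, U the set of emitted entries, and
  \<open>(s, e) \<in> F\<close> records that e has won its comparison on side s. The bound \<open>\<le> k\<close> in the third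
  conjunct replaces \<open>< k\<close> because u itself is counted.\<close>

definition merge_state ::
  "nat \<Rightarrow> nat set \<Rightarrow> (nat \<Rightarrow> bool) \<Rightarrow> nat set \<Rightarrow> (bool \<times> nat) set \<Rightarrow> (nat \<Rightarrow> 'a::linorder) set \<Rightarrow> bool" where
  "merge_state k P col U F Z \<longleftrightarrow>
     U \<subseteq> P \<and>
     (\<forall>u\<in>U. \<forall>l\<in>P. \<forall>v\<in>Z. \<forall>v'\<in>Z. (u, l) \<in> dominance k v P \<longleftrightarrow> (u, l) \<in> dominance k v' P) \<and>
     (\<forall>v\<in>Z. \<forall>u\<in>U. \<forall>l\<in>P - U. card (U \<inter> segment u l) \<le> k \<longrightarrow> v l < v u) \<and>
     (\<forall>v\<in>Z. \<forall>(s, e)\<in>F. \<forall>l\<in>P - U. on_side s e l \<longrightarrow> col l \<noteq> col e \<longrightarrow>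
        card (U \<inter> segment e l) < k \<longrightarrow> v l < v e)"

lemma merge_state_insert_flag:
  assumes "merge_state k P col U F Z" "Z' \<subseteq> Z"
    and "\<And>v l. v \<in> Z' \<Longrightarrow> l \<in> P - U \<Longrightarrow> on_side s e l \<Longrightarrow> col l \<noteq> col e \<Longrightarrow>
        card (U \<inter> segment e l) < k \<Longrightarrow> v l < v e"
  shows "merge_state k P col U (insert (s, e) F) Z'"
proof -
  have "\<forall>v\<in>Z'. \<forall>(s, e)\<in>F. \<forall>l\<in>P - U. on_side s e l \<longrightarrow> col l \<noteq> col e \<longrightarrow>
        card (U \<inter> segment e l) < k \<longrightarrow> v l < v e"
    using assms(1,2) unfolding merge_state_def by blast
  then have "\<forall>v\<in>Z'. \<forall>(s, e)\<in>insert (s, e) F. \<forall>l\<in>P - U. on_side s e l \<longrightarrow> col l \<noteq> col e \<longrightarrow>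
        card (U \<inter> segment e l) < k \<longrightarrow> v l < v e"
    using assms(3) by simp
  moreover have "U \<subseteq> P"
    "\<forall>u\<in>U. \<forall>l\<in>P. \<forall>v\<in>Z'. \<forall>v'\<in>Z'. (u, l) \<in> dominance k v P \<longleftrightarrow> (u, l) \<in> dominance k v' P"
    "\<forall>v\<in>Z'. \<forall>u\<in>U. \<forall>l\<in>P - U. card (U \<inter> segment u l) \<le> k \<longrightarrow> v l < v u"
    using assms(1,2) unfolding merge_state_def by blast+
  ultimately show ?thesis unfolding merge_state_def by blast
qed

text \<open>The flags that can ever be set: the first and the last position each lack one side.\<close>

definition flags :: "nat set \<Rightarrow> (bool \<times> nat) set" where
  "flags P = {(s, e). e \<in> P \<and> (\<exists>l\<in>P. on_side s e l)}"

lemma finite_flags: "finite P \<Longrightarrow> finite (flags P)"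
  by (rule finite_subset[of _ "UNIV \<times> P"]) (auto simp: flags_def)

lemma card_flags: "card (flags {..<N}) \<le> 2 * N - 2"
proof -
  have "flags {..<N} \<subseteq> {True} \<times> {1..<N} \<union> {False} \<times> {..<N - 1}"
    by (auto simp: flags_def on_side_def)
  then have "card (flags {..<N}) \<le> card ({True} \<times> {1..<N} \<union> {False} \<times> {..<N - 1})"
    by (rule card_mono[rotated]) auto
  also have "\<dots> \<le> card ({True} \<times> {1..<N}) + card ({False} \<times> {..<N - 1})" by (rule card_Un_le)
  finally show ?thesis by simp
qed

section \<open>One step of the emission\<close>

text \<open>The entry w is the greatest remaining one for the single array \<open>v0\<close>; other
  members of Z may rank it lower. Facts about them come from what all of Z shares: the one-colour
  profiles and the recorded state.\<close>

context
  fixes k :: nat and P :: "nat set" and col :: "nat \<Rightarrow> bool" and Z :: "(nat \<Rightarrow> 'a::linorder) set"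
    and U :: "nat set" and F :: "(bool \<times> nat) set" and v0 :: "nat \<Rightarrow> 'a" and w :: nat
  assumes P: "finite P"
    and st: "merge_state k P col U F Z"
    and inj: "\<And>v. v \<in> Z \<Longrightarrow> inj_on v P"
    and same: "\<And>v v' c. v \<in> Z \<Longrightarrow> v' \<in> Z \<Longrightarrow>
        dominance k v {p \<in> P. col p = c} = dominance k v' {p \<in> P. col p = c}"
    and v0: "v0 \<in> Z"
    and w: "w \<in> P - U" "\<And>x. x \<in> P - U \<Longrightarrow> v0 x \<le> v0 w"
begin

lemma U_sub: "U \<subseteq> P"
  using st by (simp add: merge_state_def)

lemma finite_U: "finite U"
  using U_sub P by (rule finite_subset)

lemma U_above: "v \<in> Z \<Longrightarrow> u \<in> U \<Longrightarrow> l \<in> P - U \<Longrightarrow> card (U \<inter> segment u l) \<le> k \<Longrightarrow> v l < v u"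
  using st by (simp add: merge_state_def)

lemma flag_above:
  assumes "v \<in> Z" "(s, e) \<in> F" "l \<in> P - U" "on_side s e l" "col l \<noteq> col e" "card (U \<inter> segment e l) < k"
  shows "v l < v e"
  using st assms unfolding merge_state_def by fast

lemma card_U_mono: "A \<subseteq> B \<Longrightarrow> finite B \<Longrightarrow> card (U \<inter> B) < k \<Longrightarrow> card (U \<inter> A) < k"
  by (meson Int_mono card_mono finite_Int le_less_trans order_refl)

text \<open>The comparison of x and l belongs to a one-colour profile of \<open>v0\<close>: every
  entry of their colour above x in the segment is emitted, and fewer than k are. All of Z shares
  that profile, so the comparison carries over to v.\<close>

lemma colour_dominance:
  assumes "v \<in> Z" "x \<in> P" "l \<in> P" "col x = col l" "v0 l < v0 x"
    and "\<And>e. e \<in> P \<Longrightarrow> e \<in> segment x l \<Longrightarrow> col e = col x \<Longrightarrow> v0 x < v0 e \<Longrightarrow> e \<in> U"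
    and "card (U \<inter> segment x l) < k"
  shows "v l < v x"
proof -
  let ?C = "{p \<in> P. col p = col x}"
  have "card {e \<in> ?C \<inter> segment x l. v0 x < v0 e} \<le> card (U \<inter> segment x l)"
    by (rule card_mono) (use assms in auto)
  then have "(x, l) \<in> dominance k v0 ?C" using assms by (auto simp: dominance_mem)
  then have "(x, l) \<in> dominance k v ?C" using same[OF assms(1) v0] by simp
  then show ?thesis by (simp add: dominance_mem)
qed

lemma w_beats_own_colour:
  assumes "v \<in> Z" "l \<in> P - U" "col l = col w" "l \<noteq> w" "card (U \<inter> segment w l) < k"
  shows "v l < v w"
proof (rule colour_dominance)
  show "v0 l < v0 w"
    using w assms inj[OF v0] by (metis DiffD1 inj_onD order_le_imp_less_or_eq)
  \<comment> \<open>By maximality of w, anything that \<open>v0\<close> ranks above w has been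
    emitted.\<close>
  show "e \<in> U" if "e \<in> P" "v0 w < v0 e" for e
    using w(2)[of e] that by fastforce
qed (use assms w in auto)

text \<open>What w must still beat on side s before it may be emitted: its own colour is settled by
  \<open>w_beats_own_colour\<close>, and k emitted entries hide whatever lies beyond them.\<close>

definition rivals :: "bool \<Rightarrow> nat set" where
  "rivals s = {l \<in> P - U. on_side s w l \<and> col l \<noteq> col w \<and> card (U \<inter> segment w l) < k}"

text \<open>The rival y that \<open>v0\<close> ranks highest is the top rival for every v in Z, and
  w is in turn the top entry of its colour visible from y on that side. Whichever wins therefore
  beats everything that its new flag promises.\<close>

lemma split_state:
  assumes "rivals s \<noteq> {}" "(s, w) \<notin> F"
  obtains y where "y \<in> P" "y \<noteq> w" "on_side (\<not> s) y w" "on_side s w y" "(\<not> s, y) \<notin> F"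
    "merge_state k P col U (insert (s, w) F) {v \<in> Z. v y < v w}"
    "merge_state k P col U (insert (\<not> s, y) F) {v \<in> Z. v w < v y}"
proof -
  have fin: "finite (rivals s)" using P by (simp add: rivals_def)
  obtain y where y: "y \<in> rivals s" "\<And>l. l \<in> rivals s \<Longrightarrow> v0 l \<le> v0 y"
    using finite_has_greatest[OF fin assms(1), of v0] by blast
  have yr: "y \<in> P - U" "on_side s w y" "col y \<noteq> col w" "card (U \<inter> segment w y) < k"
    using y(1) by (auto simp: rivals_def)
  \<comment> \<open>With two colours, all rivals share the colour of y, so a one-colour profile
    decides between them for every v at once.\<close>
  have top: "v l \<le> v y" if "v \<in> Z" "l \<in> rivals s" for v l
  proof (cases "l = y")
    case False
    have lr: "l \<in> P - U" "on_side s w l" "col l \<noteq> col w" "card (U \<inter> segment w l) < k"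
      using that by (auto simp: rivals_def)
    have sub: "segment y l \<subseteq> segment y w \<or> segment y l \<subseteq> segment l w"
      by (rule segment_on_side[OF yr(2) lr(2)])
    then have small: "card (U \<inter> segment y l) < k"
      using card_U_mono yr(4) lr(4) by (metis finite_segment segment_commute)
    have "v l < v y"
    proof (rule colour_dominance)
      show "v0 l < v0 y"
        using y(2)[OF that(2)] False inj[OF v0] lr(1) yr(1)
        by (metis DiffD1 inj_onD order_le_imp_less_or_eq)
      show "col y = col l" using yr lr by auto
      show "e \<in> U" if e: "e \<in> P" "e \<in> segment y l" "col e = col y" "v0 y < v0 e" for e
      proof (rule ccontr)
        \<comment> \<open>An unemitted e of this kind would be visible from w too, hence a rival
          above y.\<close>
        assume "e \<notin> U"
        have "segment e w \<subseteq> segment y w \<or> segment e w \<subseteq> segment l w"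
          using sub e(2) segment_mono by blast
        then have "card (U \<inter> segment w e) < k"
          using card_U_mono yr(4) lr(4) by (metis finite_segment segment_commute)
        then have "e \<in> rivals s"
          using e yr \<open>e \<notin> U\<close> on_side_segment[OF yr(2) lr(2) e(2)] by (auto simp: rivals_def)
        with y(2) e(4) show False by fastforce
      qed
    qed (use that small yr lr in auto)
    then show ?thesis by simp
  qed simp
  \<comment> \<open>Entries of the colour opposite to y have the colour of w; any of them visible
    from y on this side is w itself or visible from w.\<close>
  have bot: "v x \<le> v w"
    if "v \<in> Z" and x: "x \<in> P - U" "on_side (\<not> s) y x" "col x \<noteq> col y" "card (U \<inter> segment y x) < k" for v x
  proof (cases "x = w")
    case False
    have "segment w x \<subseteq> segment w y \<or> segment w x \<subseteq> segment x y"
      by (rule segment_on_side[OF on_side_flip[OF yr(2)] x(2)])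
    then have "card (U \<inter> segment w x) < k"
      using card_U_mono yr(4) x(4) by (metis finite_segment segment_commute)
    then have "v x < v w"
      using w_beats_own_colour that False yr(3) by metis
    then show ?thesis by simp
  qed simp
  have "v0 y \<le> v0 w" using w(2) yr(1) by blast
  \<comment> \<open>Were this flag set, y would beat w under \<open>v0\<close>, against the
    maximality of w.\<close>
  then have "(\<not> s, y) \<notin> F"
    using flag_above[OF v0, of "\<not> s" y w] w(1) yr on_side_flip[OF yr(2)]
    by (metis segment_commute leD)
  moreover have "merge_state k P col U (insert (s, w) F) {v \<in> Z. v y < v w}"
  proof (rule merge_state_insert_flag[OF st])
    fix v l
    assume "v \<in> {v \<in> Z. v y < v w}" "l \<in> P - U" "on_side s w l" "col l \<noteq> col w"
      "card (U \<inter> segment w l) < k"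
    then show "v l < v w" using top[of v l] by (auto simp: rivals_def intro: le_less_trans)
  qed blast
  moreover have "merge_state k P col U (insert (\<not> s, y) F) {v \<in> Z. v w < v y}"
  proof (rule merge_state_insert_flag[OF st])
    fix v l
    assume "v \<in> {v \<in> Z. v w < v y}" "l \<in> P - U" "on_side (\<not> s) y l" "col l \<noteq> col y"
      "card (U \<inter> segment y l) < k"
    then show "v l < v y" using bot[of v l] by (auto intro: le_less_trans)
  qed blast
  moreover have "y \<noteq> w" using yr(3) by blast
  ultimately show ?thesis
    using that[of y] yr on_side_flip[OF yr(2)] by blast
qed

text \<open>With no rival left on an unsettled side, w beats every visible remaining entry under
  every v in Z. The entries it dominates are then the other remaining ones with fewer than k emitted
  entries in between, a condition in which v does not occur.\<close>

lemma output_state: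
  assumes "\<forall>s. (s, w) \<in> F \<or> rivals s = {}"
  shows "merge_state k P col (insert w U) F Z"
proof -
  have beats: "v l < v w" if "v \<in> Z" "l \<in> P - U" "l \<noteq> w" "card (U \<inter> segment w l) < k" for v l
  proof (cases "col l = col w")
    case True
    then show ?thesis using w_beats_own_colour that by blast
  next
    case False
    from on_side_exhaust[OF that(3)[symmetric]] obtain s where s: "on_side s w l" ..
    then have "l \<in> rivals s" using False that by (simp add: rivals_def)
    then have "(s, w) \<in> F" using assms by blast
    then show ?thesis using flag_above that False s by blast
  qed
  \<comment> \<open>Shorten the segment until it holds exactly k emitted entries. Each of them sees
    at most k on the way to w, itself included, so each beats w.\<close>
  have many: "k \<le> card {e \<in> P \<inter> segment w l. v w < v e}"
    if v: "v \<in> Z" and c: "k \<le> card (U \<inter> segment w l)" for v l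
  proof -
    obtain p where p: "p \<in> segment w l" "card (U \<inter> segment w p) = k"
      using exact_subsegment c w(1) by blast
    have "v w < v e" if "e \<in> U \<inter> segment w p" for e
    proof (rule U_above[OF v])
      have "segment e w \<subseteq> segment w p" using that segment_mono2 by (metis IntD2 segment_commute)
      then have "card (U \<inter> segment e w) \<le> card (U \<inter> segment w p)" by (intro card_mono) auto
      then show "card (U \<inter> segment e w) \<le> k" using p by simp
    qed (use that w in auto)
    moreover have "segment w p \<subseteq> segment w l" by (rule segment_mono2[OF p(1)])
    ultimately have "card (U \<inter> segment w p) \<le> card {e \<in> P \<inter> segment w l. v w < v e}"
      using U_sub P by (intro card_mono) auto
    then show ?thesis using p by simp
  qed
  have dom: "(w, l) \<in> dominance k v P \<longleftrightarrow> l \<in> P - U \<and> l \<noteq> w \<and> card (U \<inter> segment w l) < k"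
    if v: "v \<in> Z" for v l
  proof
    assume d: "(w, l) \<in> dominance k v P"
    then have small: "card (U \<inter> segment w l) < k"
      using many[OF v, of l] by (fastforce simp: dominance_mem)
    \<comment> \<open>An emitted l this close to w would beat w by the invariant.\<close>
    moreover have "l \<notin> U"
      using U_above[OF v, of l w] w(1) small d by (fastforce simp: dominance_mem segment_commute)
    ultimately show "l \<in> P - U \<and> l \<noteq> w \<and> card (U \<inter> segment w l) < k"
      using d by (auto simp: dominance_mem)
  next
    assume l: "l \<in> P - U \<and> l \<noteq> w \<and> card (U \<inter> segment w l) < k"
    \<comment> \<open>An unemitted entry of the segment other than w is visible from w and so lies
      below it.\<close>
    have "{e \<in> P \<inter> segment w l. v w < v e} \<subseteq> U \<inter> segment w l"
    proof
      fix e assume "e \<in> {e \<in> P \<inter> segment w l. v w < v e}"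
      then have e: "e \<in> P" "e \<in> segment w l" "v w < v e" by auto
      have "card (U \<inter> segment w e) < k"
        by (rule card_U_mono[OF segment_mono2[OF e(2)]]) (use l in auto)
      then show "e \<in> U \<inter> segment w l" using beats[OF v, of e] e by fastforce
    qed
    then have "card {e \<in> P \<inter> segment w l. v w < v e} \<le> card (U \<inter> segment w l)"
      by (intro card_mono) auto
    then show "(w, l) \<in> dominance k v P"
      using l beats[OF v] w(1) by (auto simp: dominance_mem)
  qed
  have grow: "card (U \<inter> A) \<le> card (insert w U \<inter> A)" for A
    by (rule card_mono) (use finite_U in auto)
  \<comment> \<open>Inserting w raises this count, so the bound \<open>\<le> k\<close> after the
    insertion yields the strict bound before it that \<open>beats\<close> requires.\<close>
  have growS: "card (U \<inter> segment w l) < card (insert w U \<inter> segment w l)" for l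
    by (rule psubset_card_mono) (use finite_U w(1) in auto)
  have above: "v l < v u"
    if "v \<in> Z" "u \<in> insert w U" "l \<in> P - insert w U" "card (insert w U \<inter> segment u l) \<le> k" for v u l
  proof (cases "u = w")
    case True
    then show ?thesis using beats[of v l] growS[of l] that by auto
  next
    case False
    then show ?thesis using U_above[of v u l] grow[of "segment u l"] that by auto
  qed
  have fl: "v l < v e"
    if "v \<in> Z" "(s, e) \<in> F" "l \<in> P - insert w U" "on_side s e l" "col l \<noteq> col e"
      "card (insert w U \<inter> segment e l) < k" for v s e l
    using flag_above[of v s e l] grow[of "segment e l"] that by auto
  have "\<forall>u\<in>insert w U. \<forall>l\<in>P. \<forall>v\<in>Z. \<forall>v'\<in>Z. (u, l) \<in> dominance k v P \<longleftrightarrow> (u, l) \<in> dominance k v' P"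
  proof
    fix u assume "u \<in> insert w U"
    then show "\<forall>l\<in>P. \<forall>v\<in>Z. \<forall>v'\<in>Z. (u, l) \<in> dominance k v P \<longleftrightarrow> (u, l) \<in> dominance k v' P"
    proof
      assume "u = w"
      then show ?thesis using dom by simp
    next
      assume "u \<in> U"
      moreover have "\<forall>u\<in>U. \<forall>l\<in>P. \<forall>v\<in>Z. \<forall>v'\<in>Z. (u, l) \<in> dominance k v P \<longleftrightarrow> (u, l) \<in> dominance k v' P"
        using st unfolding merge_state_def by (elim conjE)
      ultimately show ?thesis by (rule bspec[rotated])
    qed
  qed
  moreover have "insert w U \<subseteq> P" using U_sub w(1) by blast
  moreover have "\<forall>v\<in>Z. \<forall>(s, e)\<in>F. \<forall>l\<in>P - insert w U. on_side s e l \<longrightarrow> col l \<noteq> col e \<longrightarrow>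
        card (insert w U \<inter> segment e l) < k \<longrightarrow> v l < v e"
    using fl by blast
  moreover have "\<forall>v\<in>Z. \<forall>u\<in>insert w U. \<forall>l\<in>P - insert w U.
      card (insert w U \<inter> segment u l) \<le> k \<longrightarrow> v l < v u"
    using above by blast
  ultimately show ?thesis
    unfolding merge_state_def by blast
qed

end

section \<open>Counting by induction over the emission\<close>

lemma finite_dominance_image: "finite P \<Longrightarrow> finite ((\<lambda>v. dominance k v P) ` Z)"
  by (rule finite_subset[of _ "Pow (P \<times> P)"]) (auto simp: dominance_def)

text \<open>A split sends each part of Z to a state with one more flag, so two bounds
  \<open>2 ^ (d - 1)\<close> add up to \<open>2 ^ d\<close> for d unset flags. An emission keeps Z
  and F and shrinks the set of remaining entries. The measure drops in both cases.\<close>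

lemma card_dominance_merge_state:
  fixes Z :: "(nat \<Rightarrow> 'a::linorder) set"
  assumes "finite P" "merge_state k P col U F Z" "F \<subseteq> flags P"
    and "\<And>v. v \<in> Z \<Longrightarrow> inj_on v P"
    and "\<And>v v' c. v \<in> Z \<Longrightarrow> v' \<in> Z \<Longrightarrow>
        dominance k v {p \<in> P. col p = c} = dominance k v' {p \<in> P. col p = c}"
  shows "card ((\<lambda>v. dominance k v P) ` Z) \<le> 2 ^ card (flags P - F)"
  using assms(2-)
proof (induction "card (P - U) + card (flags P - F)" arbitrary: U F Z rule: less_induct)
  case less
  let ?D = "\<lambda>v. dominance k v P"
  show ?case
  proof (cases "Z = {}")
    case False
    then obtain v0 where v0: "v0 \<in> Z" by blast
    show ?thesis
    proof (cases "P - U = {}")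
      case True
      \<comment> \<open>Every entry is emitted, and by the invariant the profile at emitted entries
        is common to Z.\<close>
      then have eq: "?D v = ?D v0" if "v \<in> Z" for v
        using less.prems(1) v0 that unfolding merge_state_def dominance_def by blast
      have "?D ` Z \<subseteq> {?D v0}" using eq by blast
      then have "card (?D ` Z) \<le> card {?D v0}" by (rule card_mono[rotated]) simp
      also have "\<dots> \<le> 2 ^ card (flags P - F)" by simp
      finally show ?thesis .
    next
      case False
      have "finite (P - U)" using assms(1) by simp
      then obtain w where w: "w \<in> P - U" "\<And>x. x \<in> P - U \<Longrightarrow> v0 x \<le> v0 w"
        using finite_has_greatest[OF _ False, of v0] by blast
      note ctx = assms(1) less.prems(1) less.prems(3) less.prems(4) v0 w
      show ?thesis
      proof (cases "\<exists>s. (s, w) \<notin> F \<and> rivals k P col U w s \<noteq> {}")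
        case True
        then obtain s where s: "(s, w) \<notin> F" "rivals k P col U w s \<noteq> {}" by blast
        obtain y where y: "y \<in> P" "y \<noteq> w" "on_side (\<not> s) y w" "on_side s w y" "(\<not> s, y) \<notin> F"
          "merge_state k P col U (insert (s, w) F) {v \<in> Z. v y < v w}"
          "merge_state k P col U (insert (\<not> s, y) F) {v \<in> Z. v w < v y}"
          by (rule split_state[OF ctx s(2) s(1)])
        let ?Z1 = "{v \<in> Z. v y < v w}" and ?Z2 = "{v \<in> Z. v w < v y}"
        have half: "card (?D ` Z') \<le> 2 ^ (card (flags P - F) - 1) \<and> 0 < card (flags P - F)"
          if "f \<in> flags P" "f \<notin> F" "merge_state k P col U (insert f F) Z'" "Z' \<subseteq> Z" for f Z'
        proof -
          have "flags P - insert f F = flags P - F - {f}" by blast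
          then have c: "card (flags P - insert f F) = card (flags P - F) - 1" and pos: "0 < card (flags P - F)"
            using that finite_flags[OF assms(1)] by (auto simp: card_gt_0_iff)
          have "card (?D ` Z') \<le> 2 ^ card (flags P - insert f F)"
          proof (rule less.hyps[OF _ that(3)])
            show "card (P - U) + card (flags P - insert f F) < card (P - U) + card (flags P - F)"
              using c pos by simp
            show "insert f F \<subseteq> flags P" using that(1) less.prems(2) by simp
            show "inj_on v P" if "v \<in> Z'" for v using less.prems(3) \<open>Z' \<subseteq> Z\<close> that by blast
            show "dominance k v {p \<in> P. col p = c} = dominance k v' {p \<in> P. col p = c}"
              if "v \<in> Z'" "v' \<in> Z'" for v v' c
              using less.prems(4) \<open>Z' \<subseteq> Z\<close> that by blast
          qed
          then show ?thesis using c pos by simp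
        qed
        have f1: "(s, w) \<in> flags P" "(\<not> s, y) \<in> flags P"
          using w(1) y(1,3,4) by (auto simp: flags_def)
        have "v y < v w \<or> v w < v y" if "v \<in> Z" for v
          using less.prems(3)[OF that] y(1,2) w(1) by (metis DiffD1 inj_onD neqE)
        then have "?D ` Z = ?D ` ?Z1 \<union> ?D ` ?Z2" by blast
        then have "card (?D ` Z) \<le> card (?D ` ?Z1) + card (?D ` ?Z2)"
          by (simp only: card_Un_le)
        also have "\<dots> \<le> 2 ^ (card (flags P - F) - 1) + 2 ^ (card (flags P - F) - 1)"
          using half[OF f1(1) s(1) y(6)] half[OF f1(2) y(5) y(7)] by (intro add_mono) auto
        \<comment> \<open>The truncated subtraction in the exponent is exact because an unset flag
          exists.\<close>
        also have "\<dots> = 2 ^ card (flags P - F)"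
          using half[OF f1(1) s(1) y(6)] by (cases "card (flags P - F)") auto
        finally show ?thesis .
      next
        case False
        then have "\<forall>s. (s, w) \<in> F \<or> rivals k P col U w s = {}" by blast
        from output_state[OF ctx this] have next_state: "merge_state k P col (insert w U) F Z" .
        have "P - insert w U \<subset> P - U" using w(1) by blast
        then have "card (P - insert w U) < card (P - U)"
          using assms(1) by (intro psubset_card_mono) auto
        then have "card (P - insert w U) + card (flags P - F) < card (P - U) + card (flags P - F)"
          by simp
        from less.hyps[OF this next_state less.prems(2-4)] show ?thesis .
      qed
    qed
  qed simp
qed

text \<open>At the start nothing is emitted and no flag is set, so the exponent counts all flags.
  For two interleaved rows, \<open>N = 2 * n\<close>, the bound has exponent
  \<open>4 * n - 2\<close>.\<close>

theorem card_dominance: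
  fixes Z :: "(nat \<Rightarrow> 'a::linorder) set" and col :: "nat \<Rightarrow> bool"
  assumes "\<And>v. v \<in> Z \<Longrightarrow> inj_on v {..<N}"
    and "\<And>v v' c. v \<in> Z \<Longrightarrow> v' \<in> Z \<Longrightarrow>
        dominance k v {p \<in> {..<N}. col p = c} = dominance k v' {p \<in> {..<N}. col p = c}"
  shows "card ((\<lambda>v. dominance k v {..<N}) ` Z) \<le> 2 ^ (2 * N - 2)"
proof -
  have "merge_state k {..<N} col {} {} Z" by (simp add: merge_state_def)
  from card_dominance_merge_state[OF finite_lessThan this _ assms]
  have "card ((\<lambda>v. dominance k v {..<N}) ` Z) \<le> 2 ^ card (flags {..<N} - {})" by simp
  also have "\<dots> \<le> 2 ^ (2 * N - 2)"
    using card_flags by (intro power_increasing) auto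
  finally show ?thesis .
qed

section \<open>Ranks and sorted Top-k lists\<close>

text \<open>Zero-based: for x in S this is the index of x in the descending list of S.\<close>

definition rank :: "('p \<Rightarrow> 'a::linorder) \<Rightarrow> 'p set \<Rightarrow> 'p \<Rightarrow> nat" where
  "rank v S x = card {y \<in> S. v x < v y}"

lemma rank_strict_mono:
  assumes "finite S" "x \<in> S" "v y < v x"
  shows "rank v S x < rank v S y"
  unfolding rank_def by (rule psubset_card_mono) (use assms in auto)

lemma rank_less_iff:
  assumes "finite S" "x \<in> S" "y \<in> S"
  shows "rank v S x < rank v S y \<longleftrightarrow> v y < v x"
  using rank_strict_mono[OF assms(1,2), of v y] rank_strict_mono[OF assms(1,3), of v x]
  by (cases "v x" "v y" rule: linorder_cases) (auto simp: rank_def)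

abbreviation descending :: "('p \<Rightarrow> 'a::linorder) \<Rightarrow> 'p set \<Rightarrow> 'p list \<Rightarrow> bool" where
  "descending v S xs \<equiv> distinct xs \<and> set xs = S \<and> sorted_wrt (\<lambda>p q. v q < v p) xs"

lemma descending_exists:
  assumes "finite S" "inj_on v S"
  shows "\<exists>xs. descending v S xs"
proof -
  let ?xs = "sorted_list_of_set (v ` S)"
  let ?ys = "rev (map (inv_into S v) ?xs)"
  have fin: "finite (v ` S)" using assms by simp
  have "sorted_wrt (\<lambda>p q. v p < v q) (map (inv_into S v) ?xs)"
    unfolding sorted_wrt_map
    by (rule sorted_wrt_mono_rel[OF _ strict_sorted_list_of_set[of "v ` S"]])
      (use fin in \<open>auto simp: f_inv_into_f\<close>)
  then have "sorted_wrt (\<lambda>p q. v q < v p) ?ys" by (simp add: sorted_wrt_rev)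
  moreover have "set ?ys = S" using fin assms by (auto simp: image_image)
  moreover have "distinct ?ys"
    using fin by (auto simp: distinct_map intro: inj_on_subset[OF inj_on_inv_into])
  ultimately show ?thesis by blast
qed

lemma rank_nth:
  assumes "descending v S xs" "i < length xs"
  shows "rank v S (xs ! i) = i"
proof -
  have less: "v (xs ! q) < v (xs ! p)" if "p < q" "q < length xs" for p q
    using assms(1) that by (auto simp: sorted_wrt_iff_nth_less)
  have "{y \<in> S. v (xs ! i) < v y} = (\<lambda>j. xs ! j) ` {..<i}"
  proof (intro equalityI subsetI)
    fix y assume y: "y \<in> {y \<in> S. v (xs ! i) < v y}"
    then obtain j where "j < length xs" "y = xs ! j" using assms(1) by (auto simp: in_set_conv_nth)
    then show "y \<in> (\<lambda>j. xs ! j) ` {..<i}"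
      using less[of i j] y by (cases i j rule: linorder_cases) auto
  qed (use less assms in auto)
  moreover have "inj_on (\<lambda>j. xs ! j) {..<i}"
    using assms by (auto simp: inj_on_def nth_eq_iff_index_eq)
  ultimately show ?thesis by (simp add: rank_def card_image)
qed

text \<open>The entry at index i has rank i, and ranks separate the elements of S since strict
  descent makes v injective on S.\<close>

lemma descending_unique:
  assumes "descending v S xs" "descending v S ys"
  shows "xs = ys"
proof (rule nth_equalityI)
  have "length xs = card S" "length ys = card S" using assms distinct_card by metis+
  then show len: "length xs = length ys" by simp
  fix i assume i: "i < length xs"
  have "xs ! i \<in> S" "ys ! i \<in> S" using i len assms nth_mem by metis+
  moreover have "rank v S (xs ! i) = rank v S (ys ! i)"
    using rank_nth[OF assms(1)] rank_nth[OF assms(2)] i len by simp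
  moreover have "inj_on v S"
  proof -
    have "sorted_wrt (\<lambda>p q. v q < v p) zs \<Longrightarrow> distinct (map v zs)" for zs
      by (induction zs) auto
    then have "distinct (map v xs)" using assms(1) by blast
    then show ?thesis using assms(1) by (simp add: distinct_map)
  qed
  ultimately show "xs ! i = ys ! i"
    using assms(1) rank_less_iff[of S] by (metis List.finite_set inj_onD linorder_neqE less_irrefl)
qed

lemma topk_eq_take:
  assumes "descending v S xs"
  shows "topk k v S = take k xs"
  unfolding topk_def using descending_unique[OF _ assms] assms by (metis (mono_tags, lifting) the_equality)

text \<open>Expresses the answer through ranks, so that later arguments can avoid the definite
  description.\<close>

lemma topk_nth_iff:
  assumes "finite S" "inj_on v S" "i < k"
  shows "i < length (topk k v S) \<and> topk k v S ! i = x \<longleftrightarrow> x \<in> S \<and> rank v S x = i"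
proof -
  obtain xs where xs: "descending v S xs" using descending_exists assms by blast
  have "i < length xs \<and> xs ! i = x \<longleftrightarrow> x \<in> S \<and> rank v S x = i"
    using rank_nth[OF xs] xs by (metis in_set_conv_nth)
  then show ?thesis using topk_eq_take[OF xs, of k] assms(3) by auto
qed

lemma topk_eqI:
  fixes v v' :: "'p \<Rightarrow> 'a::linorder"
  assumes "finite S" "inj_on v S" "inj_on v' S"
    and "\<And>x i. x \<in> S \<Longrightarrow> i < k \<Longrightarrow> rank v S x = i \<longleftrightarrow> rank v' S x = i"
  shows "topk k v S = topk k v' S"
proof -
  have len: "length (topk k u S) = min k (card S)" if "inj_on u S" for u :: "'p \<Rightarrow> 'a"
  proof -
    from descending_exists[OF assms(1) that] obtain xs where xs: "descending u S xs" ..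
    then show ?thesis using topk_eq_take[OF xs, of k] distinct_card[of xs] by simp
  qed
  show ?thesis
  proof (rule nth_equalityI)
    show "length (topk k v S) = length (topk k v' S)" using len assms(2,3) by simp
    fix i assume i: "i < length (topk k v S)"
    then have "i < k" using len[OF assms(2)] by simp
    then show "topk k v S ! i = topk k v' S ! i"
      using topk_nth_iff[OF assms(1,2)] topk_nth_iff[OF assms(1,3)] assms(4) i by metis
  qed
qed

lemma topk_eq_rank:
  assumes "finite S" "inj_on v S" "inj_on v' S" "topk k v S = topk k v' S"
    and "x \<in> S" "rank v S x < k"
  shows "rank v' S x = rank v S x"
  using topk_nth_iff[OF assms(1,2,6), of x] topk_nth_iff[OF assms(1,3,6), of x] assms(4,5) by simp

text \<open>Were y above x under v', then y too would have a rank below k there. Both ranks would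
  agree under v and v', placing y above x under v.\<close>

lemma topk_eq_less:
  assumes "finite S" "inj_on v S" "inj_on v' S" "topk k v S = topk k v' S"
    and "x \<in> S" "y \<in> S" "rank v S x < k" "v y < v x"
  shows "v' y < v' x"
proof (rule ccontr)
  assume "\<not> v' y < v' x"
  then have less: "v' x < v' y" using assms(3,5,6,8) by (metis inj_onD less_irrefl linorder_neqE)
  have x: "rank v' S x = rank v S x" by (rule topk_eq_rank[OF assms(1-5,7)])
  have "rank v' S y < rank v' S x" using less assms rank_less_iff by metis
  then have "rank v S y = rank v' S y"
    using topk_eq_rank[OF assms(1,3,2) assms(4)[symmetric] assms(6)] x assms(7) by simp
  moreover have "rank v S x < rank v S y" using assms rank_less_iff by metis
  ultimately show False using x \<open>rank v' S y < rank v' S x\<close> by simp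
qed

section \<open>Encodings and profile counts\<close>

text \<open>Keeps what counting uses: an integral length bound, and equal codes giving equal
  answers. Some array must exist for s to be nonnegative.\<close>

lemma encodableD:
  assumes "encodable s Arrs Qs ans" "Arrs \<noteq> {}"
  obtains enc :: "'x \<Rightarrow> bool list" where "0 \<le> s"
    "\<And>A. A \<in> Arrs \<Longrightarrow> length (enc A) \<le> nat \<lfloor>s\<rfloor>"
    "\<And>A A' q. A \<in> Arrs \<Longrightarrow> A' \<in> Arrs \<Longrightarrow> enc A = enc A' \<Longrightarrow> q \<in> Qs \<Longrightarrow> ans A q = ans A' q"
proof -
  obtain enc :: "'x \<Rightarrow> bool list" and dec where e:
    "\<forall>A\<in>Arrs. real (length (enc A)) \<le> s \<and> (\<forall>q\<in>Qs. dec (enc A) q = ans A q)"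
    using assms(1) unfolding encodable_def by blast
  show ?thesis
  proof (rule that[of enc])
    show "0 \<le> s" using e assms(2) by (meson all_not_in_conv of_nat_0_le_iff order_trans)
    show "length (enc A) \<le> nat \<lfloor>s\<rfloor>" if "A \<in> Arrs" for A
      using e that by (simp add: le_nat_floor)
    show "ans A q = ans A' q" if "A \<in> Arrs" "A' \<in> Arrs" "enc A = enc A'" "q \<in> Qs" for A A' q
      using e that by metis
  qed
qed

lemma card_short_bit_lists: "card {w :: bool list. length w \<le> L} = 2 ^ (L + 1) - 1"
proof -
  have "card {w. set w \<subseteq> (UNIV :: bool set) \<and> length w \<le> L} = (\<Sum>i\<le>L. 2 ^ i)"
    by (subst card_lists_length_le) (auto simp: card_UNIV_bool)
  moreover have "(\<Sum>i\<le>L. 2 ^ i) = (2::nat) ^ (L + 1) - 1"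
    by (induction L) auto
  ultimately show ?thesis by simp
qed

lemma finite_short_bit_lists: "finite {w :: bool list. length w \<le> L}"
  using finite_lists_length_le[of "UNIV :: bool set" L] by simp

text \<open>The converse direction: profiles that determine the answers are mapped injectively to
  bit strings of length at most L, of which there are \<open>2 ^ (L + 1) - 1\<close>.\<close>

lemma encodableI:
  assumes "finite (D ` Arrs)" "card (D ` Arrs) < 2 ^ (L + 1)" "real L \<le> s"
    and "\<And>A A' q. A \<in> Arrs \<Longrightarrow> A' \<in> Arrs \<Longrightarrow> D A = D A' \<Longrightarrow> q \<in> Qs \<Longrightarrow> ans A q = ans A' q"
  shows "encodable s Arrs Qs ans"
proof -
  have "card (D ` Arrs) \<le> card {w :: bool list. length w \<le> L}"
    using assms(2) unfolding card_short_bit_lists by simp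
  then obtain g where g: "g ` (D ` Arrs) \<subseteq> {w :: bool list. length w \<le> L}" "inj_on g (D ` Arrs)"
    using card_le_inj[OF assms(1) finite_short_bit_lists] by blast
  let ?enc = "\<lambda>A. g (D A)"
  \<comment> \<open>The decoder answers for an arbitrary array with the given code; by injectivity
    of g it has the right profile.\<close>
  let ?dec = "\<lambda>w. ans (SOME A. A \<in> Arrs \<and> ?enc A = w)"
  have "real (length (?enc A)) \<le> s" if "A \<in> Arrs" for A
  proof -
    have "length (?enc A) \<le> L" using g(1) that by blast
    then show ?thesis using assms(3) by linarith
  qed
  moreover have "?dec (?enc A) q = ans A q" if A: "A \<in> Arrs" and q: "q \<in> Qs" for A q
  proof -
    define A' where "A' = (SOME A'. A' \<in> Arrs \<and> ?enc A' = ?enc A)"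
    have "A' \<in> Arrs \<and> ?enc A' = ?enc A" unfolding A'_def by (rule someI[of _ A]) (use A in simp)
    then have "A' \<in> Arrs" "D A' = D A" using g(2) A by (auto dest: inj_onD)
    then show ?thesis using assms(4) A q unfolding A'_def[symmetric] by metis
  qed
  ultimately show ?thesis
    unfolding encodable_def by (intro exI[of _ ?enc] exI[of _ ?dec]) blast
qed

section \<open>From rows to arrays\<close>

text \<open>Membership of \<open>(w, l)\<close> is read off from the answer on
  \<open>segment w l\<close> alone. The hypotheses are symmetric, so one inclusion suffices.\<close>

lemma dominance_subset_if_topk:
  assumes "finite P" "inj_on v P" "inj_on v' P"
    and "\<And>w l. w \<in> P \<Longrightarrow> l \<in> P \<Longrightarrow> topk k v (P \<inter> segment w l) = topk k v' (P \<inter> segment w l)"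
  shows "dominance k v P \<subseteq> dominance k v' P"
proof clarify
  fix w l assume "(w, l) \<in> dominance k v P"
  then have wl: "w \<in> P" "l \<in> P" "v l < v w" "rank v (P \<inter> segment w l) w < k"
    by (auto simp: dominance_mem rank_def)
  let ?S = "P \<inter> segment w l"
  have S: "finite ?S" "inj_on v ?S" "inj_on v' ?S" "w \<in> ?S" "l \<in> ?S"
    using assms(1-3) wl by (auto intro: inj_on_subset)
  have "v' l < v' w"
    by (rule topk_eq_less[OF S(1-3) assms(4)[OF wl(1,2)] S(4,5) wl(4,3)])
  moreover have "rank v' ?S w < k"
    using topk_eq_rank[OF S(1-3) assms(4)[OF wl(1,2)] S(4) wl(4)] wl(4) by simp
  ultimately show "(w, l) \<in> dominance k v' P"
    using wl(1,2) by (simp add: dominance_mem rank_def)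
qed

lemma dominance_eq_if_ans1:
  assumes "B \<in> arrays1 n" "B' \<in> arrays1 n"
    and "\<And>q. q \<in> queries1 n \<Longrightarrow> ans1 k B q = ans1 k B' q"
  shows "dominance k B {..<n} = dominance k B' {..<n}"
proof -
  have inj: "inj_on B {..<n}" "inj_on B' {..<n}"
    using assms(1,2) by (auto simp: arrays1_def lessThan_atLeast0)
  have eq: "topk k B ({..<n} \<inter> segment w l) = topk k B' ({..<n} \<inter> segment w l)"
    if "w \<in> {..<n}" "l \<in> {..<n}" for w l
  proof -
    have "{..<n} \<inter> segment w l = {min w l .. max w l}" using that by (auto simp: segment_def)
    moreover have "(min w l, max w l) \<in> queries1 n" using that by (auto simp: queries1_def)
    ultimately show ?thesis using assms(3) by (force simp: ans1_def)
  qed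
  show ?thesis
  proof (rule antisym)
    show "dominance k B {..<n} \<subseteq> dominance k B' {..<n}"
      by (rule dominance_subset_if_topk[OF finite_lessThan inj eq])
    show "dominance k B' {..<n} \<subseteq> dominance k B {..<n}"
      by (rule dominance_subset_if_topk[OF finite_lessThan inj(2,1) eq[symmetric]])
  qed
qed

section \<open>Interleaving two rows\<close>

text \<open>Only points of the set inside a segment are counted, and a strictly monotone map
  preserves betweenness, even if gaps appear in its image.\<close>

lemma dominance_image:
  assumes "strict_mono h"
  shows "dominance k v (h ` P) = map_prod h h ` dominance k (v \<circ> h) P"
proof -
  have inj: "inj h" using assms by (rule strict_mono_imp_inj_on)
  have mem: "(h w, h l) \<in> dominance k v (h ` P) \<longleftrightarrow> (w, l) \<in> dominance k (v \<circ> h) P" for w l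
  proof -
    have "h e \<in> segment (h w) (h l) \<longleftrightarrow> e \<in> segment w l" for e
      using strict_mono_less_eq[OF assms] by (auto simp: segment_def min_le_iff_disj le_max_iff_disj)
    then have "{e \<in> h ` P \<inter> segment (h w) (h l). v (h w) < v e}
        = h ` {e \<in> P \<inter> segment w l. (v \<circ> h) w < (v \<circ> h) e}" by auto
    then have "card {e \<in> h ` P \<inter> segment (h w) (h l). v (h w) < v e}
        = card {e \<in> P \<inter> segment w l. (v \<circ> h) w < (v \<circ> h) e}"
      by (simp add: card_image[OF inj_on_subset[OF inj subset_UNIV]])
    then show ?thesis using inj by (simp add: dominance_mem inj_image_mem_iff)
  qed
  show ?thesis
  proof (intro equalityI subrelI)
    fix a b assume ab: "(a, b) \<in> dominance k v (h ` P)"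
    then obtain w l where "a = h w" "b = h l" by (auto simp: dominance_def)
    then show "(a, b) \<in> map_prod h h ` dominance k (v \<circ> h) P"
      using ab mem by (metis image_eqI map_prod_simp)
  next
    fix a b assume "(a, b) \<in> map_prod h h ` dominance k (v \<circ> h) P"
    then obtain w l where "a = h w" "b = h l" "(w, l) \<in> dominance k (v \<circ> h) P" by auto
    then show "(a, b) \<in> dominance k v (h ` P)" using mem by simp
  qed
qed

text \<open>The two rows are interleaved column by column, so that every segment of linear positions
  stays inside the column range spanned by its end points.\<close>

definition cell :: "nat \<Rightarrow> nat \<Rightarrow> nat \<Rightarrow> nat \<times> nat" where
  "cell r r' p = (if even p then r else r', p div 2)"

lemma inj_cell: "r \<noteq> r' \<Longrightarrow> inj (cell r r')"
  by (auto simp: inj_def cell_def split: if_splits) (metis dvd_div_mult_self odd_two_times_div_two_succ)+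

lemma cell_colour_class:
  fixes n :: nat
  shows "{p \<in> {..<2 * n}. even p = c} = (\<lambda>i. 2 * i + (if c then 0 else 1)) ` {..<n}"
proof (intro equalityI subsetI)
  fix p assume p: "p \<in> {p \<in> {..<2 * n}. even p = c}"
  then have "p = 2 * (p div 2) + (if c then 0 else 1)" "p div 2 < n" by auto
  then show "p \<in> (\<lambda>i. 2 * i + (if c then 0 else 1)) ` {..<n}" by blast
qed (auto split: if_splits)

text \<open>Even positions hold row r and odd ones row r', each in its column order. Row profiles
  thus supply the one-colour hypothesis of \<open>card_dominance\<close>.\<close>

lemma dominance_colour_class:
  fixes A A' :: "nat \<times> nat \<Rightarrow> 'a::linorder"
  assumes "dominance k (A \<circ> Pair r) {..<n} = dominance k (A' \<circ> Pair r) {..<n}"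
    and "dominance k (A \<circ> Pair r') {..<n} = dominance k (A' \<circ> Pair r') {..<n}"
  shows "dominance k (A \<circ> cell r r') {p \<in> {..<2 * n}. even p = c}
       = dominance k (A' \<circ> cell r r') {p \<in> {..<2 * n}. even p = c}"
proof -
  let ?h = "\<lambda>i. 2 * i + (if c then 0 else 1) :: nat"
  have "strict_mono ?h" by (auto simp: strict_mono_def)
  moreover have "A \<circ> cell r r' \<circ> ?h = A \<circ> Pair (if c then r else r')" for A :: "nat \<times> nat \<Rightarrow> 'a"
    by (auto simp: cell_def fun_eq_iff)
  ultimately show ?thesis
    unfolding cell_colour_class using assms by (cases c) (simp_all add: dominance_image)
qed

section \<open>From pairs of rows to rectangles\<close>

text \<open>The segment maps injectively into S, so no more entries lie above p in it than above
  \<open>g p\<close> in S. The comparison therefore belongs to the common profile.\<close>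

lemma dominance_transport:
  assumes "dominance k (A \<circ> g) P = dominance k (A' \<circ> g) P"
    and "inj g" "p \<in> P" "q \<in> P" "g ` segment p q \<subseteq> S" "finite S"
    and "A (g q) < A (g p)" "rank A S (g p) < k"
  shows "A' (g q) < A' (g p)"
proof -
  have "card {e \<in> P \<inter> segment p q. (A \<circ> g) p < (A \<circ> g) e} \<le> card {y \<in> S. A (g p) < A y}"
    by (rule card_inj_on_le[of g]) (use assms in \<open>auto intro: inj_on_subset\<close>)
  then have "(p, q) \<in> dominance k (A \<circ> g) P"
    using assms(3,4,7,8) by (simp add: dominance_mem rank_def)
  then show ?thesis using assms(1) by (simp add: dominance_mem)
qed

text \<open>Entries above x have smaller rank, so their victories over x carry over to A' as well; x
  keeps its own victories. The set of entries above x is unchanged.\<close>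

lemma rank_eq_if_less:
  assumes "finite S" "inj_on A S" "x \<in> S" "rank A S x < k"
    and "\<And>x y. x \<in> S \<Longrightarrow> y \<in> S \<Longrightarrow> rank A S x < k \<Longrightarrow> A y < A x \<Longrightarrow> A' y < (A' x :: 'a::linorder)"
  shows "rank A' S x = rank A S x"
proof -
  have "A x < A y \<longleftrightarrow> A' x < A' y" if y: "y \<in> S" for y
  proof
    assume less: "A x < A y"
    then have "rank A S y < rank A S x" using rank_strict_mono[OF assms(1) y] by blast
    then show "A' x < A' y" using assms(5)[OF y assms(3) _ less] assms(4) by simp
  next
    assume less: "A' x < A' y"
    show "A x < A y"
    proof (rule ccontr)
      assume "\<not> A x < A y"
      then have "A y < A x" using assms(2,3) y less by (metis inj_onD less_irrefl neqE)
      then show False using assms(5)[OF assms(3) y assms(4)] less by simp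
    qed
  qed
  then show ?thesis unfolding rank_def by (metis (mono_tags, lifting) Collect_cong)
qed

text \<open>Two cells lie in one row or in one pair of rows, and the segment joining them there maps
  into the rectangle, where x has rank below k.\<close>

lemma pairwise_dominance_less:
  assumes rows: "\<And>r. r < m \<Longrightarrow> dominance k (A \<circ> Pair r) {..<n} = dominance k (A' \<circ> Pair r) {..<n}"
    and pairs: "\<And>r r'. r < r' \<Longrightarrow> r' < m \<Longrightarrow>
        dominance k (A \<circ> cell r r') {..<2 * n} = dominance k (A' \<circ> cell r r') {..<2 * n}"
    and jb: "j < m" "b < n" and x: "x \<in> {i..j} \<times> {a..b}" and y: "y \<in> {i..j} \<times> {a..b}"
    and less: "A y < A x" and rank: "rank A ({i..j} \<times> {a..b}) x < k"
  shows "A' y < A' x"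
proof -
  let ?S = "{i..j} \<times> {a..b}"
  obtain r c where rc: "x = (r, c)" by (cases x)
  obtain r' d where rd: "y = (r', d)" by (cases y)
  have bnd: "i \<le> r" "r \<le> j" "a \<le> c" "c \<le> b" "i \<le> r'" "r' \<le> j" "a \<le> d" "d \<le> b"
    using x y rc rd by auto
  have key: "A' y < A' x"
    if "dominance k (A \<circ> g) P = dominance k (A' \<circ> g) P" "inj g" "p \<in> P" "q \<in> P"
      "g ` segment p q \<subseteq> ?S" "g p = x" "g q = y" for g P p q
    using dominance_transport[of k A g P A' p q ?S] that less rank by simp
  consider "r = r'" | "r < r'" | "r' < r" by linarith
  then show ?thesis
  proof cases
    case 1
    show ?thesis
      by (rule key[OF rows[of r], of c d])
        (use 1 bnd jb rc rd in \<open>auto simp: inj_def segment_def\<close>)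
  next
    case 2
    show ?thesis
      by (rule key[OF pairs[OF 2], of "2 * c" "2 * d + 1"])
        (use 2 bnd jb rc rd in \<open>auto simp: inj_cell segment_def cell_def\<close>)
  next
    case 3
    \<comment> \<open>A pair lists its smaller row first, so here x takes the odd position and y the
      even one.\<close>
    show ?thesis
      by (rule key[OF pairs[OF 3], of "2 * c + 1" "2 * d"])
        (use 3 bnd jb rc rd in \<open>auto simp: inj_cell segment_def cell_def\<close>)
  qed
qed

lemma ans2_eq_if_pairwise_dominance:
  fixes A A' :: "nat \<times> nat \<Rightarrow> 'a::linorder"
  assumes "A \<in> arrays2 m n" "A' \<in> arrays2 m n" "q \<in> queries2 m n"
    and rows: "\<And>r. r < m \<Longrightarrow> dominance k (A \<circ> Pair r) {..<n} = dominance k (A' \<circ> Pair r) {..<n}"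
    and pairs: "\<And>r r'. r < r' \<Longrightarrow> r' < m \<Longrightarrow>
        dominance k (A \<circ> cell r r') {..<2 * n} = dominance k (A' \<circ> cell r r') {..<2 * n}"
  shows "ans2 k A q = ans2 k A' q"
proof -
  obtain i j a b where q: "q = (i, j, a, b)" "i \<le> j" "j < m" "a \<le> b" "b < n"
    using assms(3) by (auto simp: queries2_def)
  let ?S = "{i..j} \<times> {a..b}"
  have "?S \<subseteq> {0..<m} \<times> {0..<n}" using q by auto
  then have inj: "inj_on A ?S" "inj_on A' ?S"
    using assms(1,2) unfolding arrays2_def by (auto intro: inj_on_subset)
  have "topk k A ?S = topk k A' ?S"
  proof (rule topk_eqI)
    fix x t assume x: "x \<in> ?S" and t: "t < k"
    have "rank A' ?S x = rank A ?S x" if "rank A ?S x < k"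
      by (rule rank_eq_if_less[OF _ inj(1) x that])
        (use pairwise_dominance_less[OF rows pairs q(3,5)] in auto)
    \<comment> \<open>Both directions are needed, since either of the two ranks may be the one known
      to be below k.\<close>
    moreover have "rank A ?S x = rank A' ?S x" if "rank A' ?S x < k"
      by (rule rank_eq_if_less[OF _ inj(2) x that])
        (use pairwise_dominance_less[OF rows[symmetric] pairs[symmetric] q(3,5)] in auto)
    ultimately show "rank A ?S x = t \<longleftrightarrow> rank A' ?S x = t" using t by metis
  qed (use inj in auto)
  then show ?thesis by (simp add: ans2_def q(1))
qed

section \<open>Counting the profiles of whole arrays\<close>

lemma row_in_arrays1:
  assumes "A \<in> arrays2 m n" "r < m"
  shows "A \<circ> Pair r \<in> arrays1 n"
proof -
  have "Pair r ` {0..<n} \<subseteq> {0..<m} \<times> {0..<n}" using assms(2) by auto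
  then have "inj_on A (Pair r ` {0..<n})"
    using assms(1) inj_on_subset unfolding arrays2_def by blast
  then show ?thesis unfolding arrays1_def by (simp add: comp_inj_on inj_on_def)
qed

lemma finite_row_pairs: "finite {(r, r'). r < r' \<and> r' < (m::nat)}"
  by (rule finite_subset[of _ "{..<m} \<times> {..<m}"]) auto

lemma card_row_pairs: "2 * card {(r, r'). r < r' \<and> r' < (m::nat)} = m * (m - 1)"
proof (induction m)
  case (Suc m)
  have "{(r, r'). r < r' \<and> r' < Suc m} = {(r, r'). r < r' \<and> r' < m} \<union> {..<m} \<times> {m}"
    by (auto simp: less_Suc_eq)
  then have "card {(r, r'). r < r' \<and> r' < Suc m}
      = card {(r, r'). r < r' \<and> r' < m} + card ({..<m} \<times> {m})"
    using finite_row_pairs[of m] by (simp add: card_Un_disjoint disjoint_iff)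
  then show ?case using Suc by (cases m) (auto simp: algebra_simps)
qed simp

lemma card_PiE_le:
  assumes "finite I" "\<And>i. i \<in> I \<Longrightarrow> card (X i) \<le> c"
  shows "card (PiE I X) \<le> c ^ card I"
proof -
  have "(\<Prod>i\<in>I. card (X i)) \<le> (\<Prod>i\<in>I. c)" by (rule prod_mono) (use assms in auto)
  then show ?thesis using assms(1) by (simp add: card_PiE)
qed

text \<open>Allowing shorter row codes costs at most one bit per row, m in all, while the pairs save
  \<open>m * (m - 1)\<close> bits; and \<open>m \<le> m * (m - 1) + 1\<close>. For
  \<open>m = 1\<close> the exponents coincide and strictness comes from the subtracted 1.\<close>

lemma code_count_bound:
  fixes m n F c :: nat
  assumes "0 < m" "0 < n" "2 * c = m * (m - 1)"
  shows "(2 ^ (F + 1) - 1) ^ m * (2 ^ (4 * n - 2)) ^ c < (2::nat) ^ (m * F + 2 * n * m * (m - 1) + 1)"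
proof -
  have "(2 ^ (F + 1) - 1) ^ m < ((2::nat) ^ (F + 1)) ^ m"
    using assms(1) by (intro power_strict_mono) auto
  then have "(2 ^ (F + 1) - 1) ^ m * (2 ^ (4 * n - 2)) ^ c < ((2::nat) ^ (F + 1)) ^ m * (2 ^ (4 * n - 2)) ^ c"
    by simp
  also have "\<dots> = 2 ^ ((F + 1) * m + (4 * n - 2) * c)"
    by (simp only: power_mult power_add)
  also have "\<dots> \<le> 2 ^ (m * F + 2 * n * m * (m - 1) + 1)"
  proof (rule power_increasing)
    obtain m' n' where mn: "m = Suc m'" "n = Suc n'" using assms(1,2) by (metis gr0_implies_Suc)
    have "(4 * n - 2) * c = (2 * n' + 1) * (m * m')"
    proof -
      have "(4 * n - 2) * c = (2 * n' + 1) * (2 * c)" using mn by (simp add: algebra_simps)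
      then show ?thesis using assms(3) mn by simp
    qed
    then show "(F + 1) * m + (4 * n - 2) * c \<le> m * F + 2 * n * m * (m - 1) + 1"
      using mn by (simp add: algebra_simps)
  qed simp
  finally show ?thesis .
qed

text \<open>The profile of an array consists of its row codes and one dominance relation per pair of
  rows. It determines all answers, so only the number of profiles has to be bounded.\<close>

lemma encodable_rows_to_array:
  assumes "0 < m" "m \<le> n" and enc1: "encodable s (arrays1 n :: (nat \<Rightarrow> 'a::linorder) set) (queries1 n) (ans1 k)"
  shows "encodable (real m * s + 2 * real n * real m * (real m - 1))
    (arrays2 m n :: (nat \<times> nat \<Rightarrow> 'a) set) (queries2 m n) (ans2 k)"
proof (cases "arrays2 m n = ({} :: (nat \<times> nat \<Rightarrow> 'a) set)")
  \<comment> \<open>There may be no array with distinct entries at all, when the value type is too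
    small.\<close>
  case True
  then show ?thesis by (simp add: encodable_def)
next
  case False
  let ?Arrs = "arrays2 m n :: (nat \<times> nat \<Rightarrow> 'a) set"
  let ?Q = "{(r, r'). r < r' \<and> r' < m}"
  have "arrays1 n \<noteq> ({} :: (nat \<Rightarrow> 'a) set)" using False row_in_arrays1 assms(1) by blast
  then obtain enc :: "(nat \<Rightarrow> 'a) \<Rightarrow> bool list" where s: "0 \<le> s"
    and short: "\<And>B. B \<in> arrays1 n \<Longrightarrow> length (enc B) \<le> nat \<lfloor>s\<rfloor>"
    and determines: "\<And>B B' q. B \<in> arrays1 n \<Longrightarrow> B' \<in> arrays1 n \<Longrightarrow> enc B = enc B' \<Longrightarrow>
        q \<in> queries1 n \<Longrightarrow> ans1 k B q = ans1 k B' q"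
    using encodableD[OF enc1] by metis
  define F where "F = nat \<lfloor>s\<rfloor>"
  \<comment> \<open>Restriction fixes the values outside the index sets, so that profiles lie in
    finite function spaces.\<close>
  define codes where "codes A = restrict (\<lambda>r. enc (A \<circ> Pair r)) {..<m}" for A
  define pairs where "pairs A = restrict (\<lambda>(r, r'). dominance k (A \<circ> cell r r') {..<2 * n}) ?Q"
    for A :: "nat \<times> nat \<Rightarrow> 'a"
  let ?fib = "\<lambda>E. {A \<in> ?Arrs. codes A = E}"
  have row_dom: "dominance k (A \<circ> Pair r) {..<n} = dominance k (A' \<circ> Pair r) {..<n}"
    if "A \<in> ?Arrs" "A' \<in> ?Arrs" "codes A = codes A'" "r < m" for A A' r
  proof (rule dominance_eq_if_ans1)
    have "enc (A \<circ> Pair r) = enc (A' \<circ> Pair r)"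
      using fun_cong[OF that(3), of r] that(4) by (simp add: codes_def)
    then show "ans1 k (A \<circ> Pair r) q = ans1 k (A' \<circ> Pair r) q" if "q \<in> queries1 n" for q
      using determines row_in_arrays1 \<open>A \<in> ?Arrs\<close> \<open>A' \<in> ?Arrs\<close> \<open>r < m\<close> that by blast
  qed (use that row_in_arrays1 in auto)
  have codes_sub: "codes ` ?Arrs \<subseteq> PiE {..<m} (\<lambda>_. {w. length w \<le> F})"
    unfolding codes_def F_def using short[OF row_in_arrays1] by (auto simp: PiE_def Pi_def)
  have fin_codes: "finite (codes ` ?Arrs)"
    by (rule finite_subset[OF codes_sub]) (auto intro!: finite_PiE finite_short_bit_lists)
  have "card (codes ` ?Arrs) \<le> card (PiE {..<m} (\<lambda>_. {w :: bool list. length w \<le> F}))"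
    by (rule card_mono[OF _ codes_sub]) (auto intro!: finite_PiE finite_short_bit_lists)
  then have card_codes: "card (codes ` ?Arrs) \<le> (2 ^ (F + 1) - 1) ^ m"
    by (simp add: card_PiE card_short_bit_lists)
  \<comment> \<open>Fixing the row codes fixes all row profiles, so \<open>card_dominance\<close>
    applies to each pair of rows separately.\<close>
  have fib: "finite (pairs ` ?fib E) \<and> card (pairs ` ?fib E) \<le> (2 ^ (4 * n - 2)) ^ card ?Q" for E
  proof -
    define X where "X = (\<lambda>(r, r'). (\<lambda>A. dominance k (A \<circ> cell r r') {..<2 * n}) ` ?fib E)"
    have X: "finite (X rr) \<and> card (X rr) \<le> 2 ^ (4 * n - 2)" if "rr \<in> ?Q" for rr
    proof -
      obtain r r' where rr: "rr = (r, r')" "r < r'" "r' < m" using \<open>rr \<in> ?Q\<close> by blast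
      let ?Z = "(\<lambda>A. A \<circ> cell r r') ` ?fib E"
      have img: "X rr = (\<lambda>v. dominance k v {..<2 * n}) ` ?Z"
        by (simp add: X_def rr(1) image_image)
      have "card ((\<lambda>v. dominance k v {..<2 * n}) ` ?Z) \<le> 2 ^ (2 * (2 * n) - 2)"
      proof (rule card_dominance[where col = even])
        fix v assume "v \<in> ?Z"
        then obtain A where A: "A \<in> ?Arrs" "v = A \<circ> cell r r'" by blast
        have "cell r r' ` {..<2 * n} \<subseteq> {0..<m} \<times> {0..<n}" using rr by (auto simp: cell_def)
        then have "inj_on A (cell r r' ` {..<2 * n})"
          using A(1) unfolding arrays2_def by (auto intro: inj_on_subset)
        then show "inj_on v {..<2 * n}"
          unfolding A(2) using inj_cell[of r r'] rr(2)
          by (intro comp_inj_on) (auto intro: inj_on_subset)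
      next
        fix v v' c assume "v \<in> ?Z" "v' \<in> ?Z"
        then obtain A A' where "A \<in> ?fib E" "A' \<in> ?fib E" "v = A \<circ> cell r r'" "v' = A' \<circ> cell r r'"
          by blast
        then show "dominance k v {p \<in> {..<2 * n}. even p = c} = dominance k v' {p \<in> {..<2 * n}. even p = c}"
          using dominance_colour_class[OF row_dom row_dom, of A A' r r' c] rr by simp
      qed
      then show ?thesis using finite_dominance_image[of "{..<2 * n}" k ?Z] img by simp
    qed
    have sub: "pairs ` ?fib E \<subseteq> PiE ?Q X"
      unfolding pairs_def X_def by (rule image_subsetI) (simp only: restrict_PiE_iff, blast)
    have fin: "finite (PiE ?Q X)" using X finite_row_pairs[of m] by (blast intro: finite_PiE)
    have "card (pairs ` ?fib E) \<le> card (PiE ?Q X)" by (rule card_mono[OF fin sub])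
    also have "\<dots> \<le> (2 ^ (4 * n - 2)) ^ card ?Q"
      using X by (intro card_PiE_le finite_row_pairs) blast
    finally show ?thesis using finite_subset[OF sub fin] by blast
  qed
  let ?D = "\<lambda>A. (codes A, pairs A)"
  \<comment> \<open>A dependent sum, as the bound on \<open>pairs\<close> is for arrays with the
    same row codes.\<close>
  let ?T = "SIGMA E : codes ` ?Arrs. pairs ` ?fib E"
  have sub: "?D ` ?Arrs \<subseteq> ?T" by auto
  have finT: "finite ?T" using fin_codes fib by blast
  have "card (?D ` ?Arrs) \<le> card ?T" by (rule card_mono[OF finT sub])
  also have "\<dots> = (\<Sum>E\<in>codes ` ?Arrs. card (pairs ` ?fib E))"
    using fin_codes fib by (intro card_SigmaI) auto
  also have "\<dots> \<le> (\<Sum>E\<in>codes ` ?Arrs. (2 ^ (4 * n - 2)) ^ card ?Q)"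
    using fib by (intro sum_mono) blast
  also have "\<dots> = card (codes ` ?Arrs) * (2 ^ (4 * n - 2)) ^ card ?Q" by simp
  also have "\<dots> \<le> (2 ^ (F + 1) - 1) ^ m * (2 ^ (4 * n - 2)) ^ card ?Q"
    using card_codes by (rule mult_right_mono) simp
  also have "\<dots> < 2 ^ (m * F + 2 * n * m * (m - 1) + 1)"
    using assms(1,2) card_row_pairs by (intro code_count_bound) auto
  finally have count: "card (?D ` ?Arrs) < 2 ^ (m * F + 2 * n * m * (m - 1) + 1)" .
  show ?thesis
  proof (rule encodableI[OF finite_subset[OF sub finT] count])
    have "real F \<le> s" using s by (simp add: F_def)
    then have "real m * real F \<le> real m * s" by (intro mult_left_mono) auto
    then show "real (m * F + 2 * n * m * (m - 1)) \<le> real m * s + 2 * real n * real m * (real m - 1)"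
      using assms(1) by (simp add: of_nat_diff)
  next
    fix A A' q assume A: "A \<in> ?Arrs" "A' \<in> ?Arrs" "?D A = ?D A'" and q: "q \<in> queries2 m n"
    show "ans2 k A q = ans2 k A' q"
    proof (rule ans2_eq_if_pairwise_dominance[OF A(1,2) q])
      show "dominance k (A \<circ> Pair r) {..<n} = dominance k (A' \<circ> Pair r) {..<n}" if "r < m" for r
        using row_dom A that by blast
      show "dominance k (A \<circ> cell r r') {..<2 * n} = dominance k (A' \<circ> cell r r') {..<2 * n}"
        if "r < r'" "r' < m" for r r'
      proof -
        have "pairs A (r, r') = pairs A' (r, r')" using A(3) by simp
        then show ?thesis using that by (simp add: pairs_def)
      qed
    qed
  qed
qed

theorem theorem7:
  shows "(\<forall>(m::nat) (n::nat) (k::nat) (s::real).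
            m \<le> n \<and> 1 \<le> k \<and> encodable s (arrays1 n :: (nat \<Rightarrow> 'a::linorder) set) (queries1 n) (ans1 k)
            \<longrightarrow> encodable (real m * s + 2 * real n * real m * (real m - 1))
                  (arrays2 m n :: (nat \<times> nat \<Rightarrow> 'a) set) (queries2 m n) (ans2 k))
       \<and> (\<forall>(m::nat) (k::nat) (f::nat \<Rightarrow> real).
            1 \<le> k \<and> f \<in> o(\<lambda>n. real n) \<and>
            (\<forall>n. encodable (log 2 (real ((k + 1) * n choose n)) + f n)
                   (arrays1 n :: (nat \<Rightarrow> 'a) set) (queries1 n) (ans1 k))
            \<longrightarrow> (\<exists>g::nat \<Rightarrow> real. g \<in> o(\<lambda>n. real n) \<and>
                  (\<forall>n. m \<le> n \<longrightarrow>
                     encodable (real m * log 2 (real ((k + 1) * n choose n))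
                                + 2 * real n * real m * (real m - 1) + g n)
                       (arrays2 m n :: (nat \<times> nat \<Rightarrow> 'a) set) (queries2 m n) (ans2 k))))"
    (is "?general \<and> ?asymptotic")
proof
  show general: ?general
  proof (intro allI impI)
    fix m n k :: nat and s :: real
    assume *: "m \<le> n \<and> 1 \<le> k \<and> encodable s (arrays1 n :: (nat \<Rightarrow> 'a) set) (queries1 n) (ans1 k)"
    show "encodable (real m * s + 2 * real n * real m * (real m - 1))
        (arrays2 m n :: (nat \<times> nat \<Rightarrow> 'a) set) (queries2 m n) (ans2 k)"
    proof (cases "m = 0")
      case True
      \<comment> \<open>Without rows there are no queries and the budget is 0, so the empty string
        serves.\<close>
      then show ?thesis by (auto simp: encodable_def queries2_def intro!: exI[of _ "\<lambda>_. []"])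
    next
      case False
      then show ?thesis using encodable_rows_to_array * by blast
    qed
  qed
  show ?asymptotic
  proof (intro allI impI)
    fix m k :: nat and f :: "nat \<Rightarrow> real"
    assume *: "1 \<le> k \<and> f \<in> o(\<lambda>n. real n) \<and>
        (\<forall>n. encodable (log 2 (real ((k + 1) * n choose n)) + f n)
           (arrays1 n :: (nat \<Rightarrow> 'a) set) (queries1 n) (ans1 k))"
    \<comment> \<open>The lower-order term is paid once per row, and m stays fixed while n
      grows.\<close>
    let ?g = "\<lambda>n. real m * f n"
    have "?g \<in> o(\<lambda>n. real n)" using * by (cases "m = 0") auto
    moreover have "encodable (real m * log 2 (real ((k + 1) * n choose n))
        + 2 * real n * real m * (real m - 1) + ?g n)
        (arrays2 m n :: (nat \<times> nat \<Rightarrow> 'a) set) (queries2 m n) (ans2 k)" if "m \<le> n" for n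
    proof -
      let ?s = "log 2 (real ((k + 1) * n choose n)) + f n"
      have "encodable (real m * ?s + 2 * real n * real m * (real m - 1))
          (arrays2 m n :: (nat \<times> nat \<Rightarrow> 'a) set) (queries2 m n) (ans2 k)"
        using general * that by blast
      then show ?thesis by (simp add: algebra_simps)
    qed
    ultimately show "\<exists>g::nat \<Rightarrow> real. g \<in> o(\<lambda>n. real n) \<and>
        (\<forall>n. m \<le> n \<longrightarrow>
           encodable (real m * log 2 (real ((k + 1) * n choose n))
                      + 2 * real n * real m * (real m - 1) + g n)
             (arrays2 m n :: (nat \<times> nat \<Rightarrow> 'a) set) (queries2 m n) (ans2 k))" by blast
  qed
qed

end
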